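(* Let $d_A,d_B\ge1$ be integers, and let $K_B$ be the $(d_Ad_B)^2\times(d_Ad_B)^2$ matrix representing the partial transposition, i.e. $\mathrm{vec}\,X^{T_B}=K_B\,\mathrm{vec}\,X$ for all complex $d_Ad_B\times d_Ad_B$ matrices $X$. Let $$\mathbb{E}_{S}=\{J_{d_B}^{ij}+J_{d_B}^{ji}-J_{d_B}^{ij}J_{d_B}^{ij}\,:\,1\le i\le j\le d_B\},\qquad \mathbb{E}_{AS}=\{J_{d_B}^{ij}-J_{d_B}^{ji}\,:\,1\le i<j\le d_B\},$$ and let $\mathbb{E}=\{J_{d_A}^{ij}\otimes M\,:\,1\le i,j\le d_A,\ M\in\mathbb{E}_S\cup\mathbb{E}_{AS}\}$, where each matrix is normalized by its Frobenius norm and the elements are ordered so that those with $M\in\mathbb{E}_S$ come first. Let $V^{\mathbb{E}}$ be the matrix whose columns are the vectorizations of the (normalized, ordered) matrices in $\mathbb{E}$. Then $$K_B=V^{\mathbb{E}}\begin{bmatrix}I_k&0\\0&-I_l\end{bmatrix}\left(V^{\mathbb{E}}\right)^T,\qquad k=\tfrac12d_A^2d_B(d_B+1),\quad l=\tfrac12d_A^2d_B(d_B-1).$$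
   Context: $\otimes$ is the Kronecker product, $I_m$ is the $m\times m$ identity matrix, and $J_m^{ij}$ is the $m\times m$ single-entry matrix with $(J_m^{ij})_{kl}=\delta_{ik}\delta_{jl}$. $\mathrm{vec}\,X$ is the column vector obtained by stacking the columns of $X$. The partial transpose $X\mapsto X^{T_B}$ is the complex-linear map on $d_Ad_B\times d_Ad_B$ matrices determined by $(Y\otimes Z)^{T_B}=Y\otimes Z^T$ for $Y$ of size $d_A\times d_A$ and $Z$ of size $d_B\times d_B$. *)

theory Defs
  imports Complex_Main "Jordan_Normal_Form.Matrix"
begin

text \<open>All matrix indices are 0-based, as in \<open>Jordan_Normal_Form\<close>: the index range
  \<open>1 \<le> i \<le> m\<close> becomes \<open>i < m\<close>.\<close>

definition single_entry :: "nat \<Rightarrow> nat \<Rightarrow> nat \<Rightarrow> complex mat" where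
  "single_entry m i j = mat m m (\<lambda>(k, l). if k = i \<and> l = j then 1 else 0)"

definition kronecker :: "complex mat \<Rightarrow> complex mat \<Rightarrow> complex mat" (infixl \<open>\<otimes>\<^sub>K\<close> 70) where
  "A \<otimes>\<^sub>K B = mat (dim_row A * dim_row B) (dim_col A * dim_col B)
     (\<lambda>(r, c). A $$ (r div dim_row B, c div dim_col B) * B $$ (r mod dim_row B, c mod dim_col B))"

text \<open>Column stacking: entry \<open>(r, c)\<close> of \<open>X\<close> goes to position \<open>c * dim_row X + r\<close>.\<close>

definition vectorize :: "complex mat \<Rightarrow> complex vec" where
  "vectorize X = vec (dim_row X * dim_col X) (\<lambda>p. X $$ (p mod dim_row X, p div dim_row X))"

definition frobenius_norm :: "complex mat \<Rightarrow> real" where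
  "frobenius_norm X = sqrt (\<Sum>r<dim_row X. \<Sum>c<dim_col X. (cmod (X $$ (r, c)))\<^sup>2)"

definition normalize_mat :: "complex mat \<Rightarrow> complex mat" where
  "normalize_mat X = complex_of_real (1 / frobenius_norm X) \<cdot>\<^sub>m X"

definition is_partial_transpose :: "nat \<Rightarrow> nat \<Rightarrow> (complex mat \<Rightarrow> complex mat) \<Rightarrow> bool" where
  "is_partial_transpose dA dB T \<longleftrightarrow>
     (\<forall>X \<in> carrier_mat (dA * dB) (dA * dB). T X \<in> carrier_mat (dA * dB) (dA * dB)) \<and>
     (\<forall>X \<in> carrier_mat (dA * dB) (dA * dB). \<forall>Y \<in> carrier_mat (dA * dB) (dA * dB).
        T (X + Y) = T X + T Y) \<and>
     (\<forall>c. \<forall>X \<in> carrier_mat (dA * dB) (dA * dB). T (c \<cdot>\<^sub>m X) = c \<cdot>\<^sub>m T X) \<and>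
     (\<forall>Y \<in> carrier_mat dA dA. \<forall>Z \<in> carrier_mat dB dB. T (Y \<otimes>\<^sub>K Z) = Y \<otimes>\<^sub>K transpose_mat Z)"

definition represents :: "nat \<Rightarrow> complex mat \<Rightarrow> (complex mat \<Rightarrow> complex mat) \<Rightarrow> bool" where
  "represents n K T \<longleftrightarrow> K \<in> carrier_mat (n\<^sup>2) (n\<^sup>2) \<and>
     (\<forall>X \<in> carrier_mat n n. vectorize (T X) = K *\<^sub>v vectorize X)"

definition E_S :: "nat \<Rightarrow> complex mat set" where
  "E_S d = {single_entry d i j + single_entry d j i - single_entry d i j * single_entry d i j
             | i j. i \<le> j \<and> j < d}"

definition E_AS :: "nat \<Rightarrow> complex mat set" where
  "E_AS d = {single_entry d i j - single_entry d j i | i j. i < j \<and> j < d}"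

definition product_family :: "nat \<Rightarrow> complex mat set \<Rightarrow> complex mat set" where
  "product_family dA \<M> =
     {normalize_mat (single_entry dA i j \<otimes>\<^sub>K M) | i j M. i < dA \<and> j < dA \<and> M \<in> \<M>}"

text \<open>\<open>Es\<close> lists each normalized element of the family exactly once, those coming from
  \<open>E_S\<close> before all the others; the order is otherwise arbitrary.\<close>

definition is_ordered_family :: "nat \<Rightarrow> nat \<Rightarrow> complex mat list \<Rightarrow> bool" where
  "is_ordered_family dA dB Es \<longleftrightarrow>
     distinct Es \<and>
     set Es = product_family dA (E_S dB \<union> E_AS dB) \<and>
     (\<forall>q < length Es. \<forall>p < q. Es ! q \<in> product_family dA (E_S dB) \<longrightarrow>
        Es ! p \<in> product_family dA (E_S dB))"

definition vec_matrix :: "nat \<Rightarrow> complex mat list \<Rightarrow> complex mat" where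
  "vec_matrix n Es = mat_of_cols (n\<^sup>2) (map vectorize Es)"

text \<open>Sanity check: a partial transposition and a matrix representing it exist.\<close>

lemma div_mult_add_less:
  fixes a b r m :: nat
  assumes "r < a * b" "m < b" shows "r div b * b + m < a * b"
proof -
  have "r div b < a" using assms by (simp add: less_mult_imp_div_less)
  then have "(r div b + 1) * b \<le> a * b" by (intro mult_right_mono) auto
  then show ?thesis using assms(2) by (simp add: algebra_simps)
qed

lemma partial_transpose_exists:
  assumes "dB \<ge> 1"
  shows "\<exists>T. is_partial_transpose dA dB T"
proof -
  let ?n = "dA * dB"
  have pos: "0 < dB" using assms by simp
  let ?T = "\<lambda>X :: complex mat. mat ?n ?n
    (\<lambda>(r, c). X $$ (r div dB * dB + c mod dB, c div dB * dB + r mod dB))"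
  have "is_partial_transpose dA dB ?T"
    unfolding is_partial_transpose_def
    by (auto intro!: eq_matI simp: kronecker_def div_mult_add_less mod_less_divisor
          less_mult_imp_div_less pos)
  then show ?thesis by blast
qed

lemma representing_matrix_exists:
  assumes T: "is_partial_transpose dA dB T"
  shows "\<exists>K. represents (dA * dB) K T"
proof -
  define n where "n = dA * dB"
  define F where "F q = (mat n n (\<lambda>(r, c). if c * n + r = q then 1 else 0) :: complex mat)" for q
  define K where "K = mat (n\<^sup>2) (n\<^sup>2) (\<lambda>(p, q). T (F q) $$ (p mod n, p div n))"
  have car: "T X \<in> carrier_mat n n" if "X \<in> carrier_mat n n" for X
    using T that unfolding is_partial_transpose_def n_def by blast
  have add: "T (X + Y) = T X + T Y" if "X \<in> carrier_mat n n" "Y \<in> carrier_mat n n" for X Y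
    using T that unfolding is_partial_transpose_def n_def by blast
  have smult: "T (c \<cdot>\<^sub>m X) = c \<cdot>\<^sub>m T X" if "X \<in> carrier_mat n n" for c X
    using T that unfolding is_partial_transpose_def n_def by blast
  have Fc: "F q \<in> carrier_mat n n" for q by (simp add: F_def)
  have main: "vectorize (T X) = K *\<^sub>v vectorize X" if X: "X \<in> carrier_mat n n" for X
  proof -
    define P where "P m = mat n n (\<lambda>(r, c). if c * n + r < m then X $$ (r, c) else 0)" for m
    define x where "x q = X $$ (q mod n, q div n)" for q
    have Pc: "P m \<in> carrier_mat n n" for m by (simp add: P_def)
    have pos: "(c * n + r) mod n = r" "(c * n + r) div n = c" if "r < n" for r c
      using that by auto
    have step: "P (Suc m) = P m + x m \<cdot>\<^sub>m F m" for m
      by (rule eq_matI) (auto simp: P_def F_def x_def pos less_Suc_eq)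
    have part: "T (P m) $$ (r, c) = (\<Sum>q<m. x q * T (F q) $$ (r, c))"
      if r: "r < n" and c: "c < n" for m r c
    proof (induction m)
      case 0
      have "P 0 = 0 \<cdot>\<^sub>m X" using X by (intro eq_matI) (auto simp: P_def)
      then show ?case using smult[OF X, of 0] car[OF X] r c by auto
    next
      case (Suc m)
      have "T (P (Suc m)) = T (P m) + x m \<cdot>\<^sub>m T (F m)"
        using step add[OF Pc, of "x m \<cdot>\<^sub>m F m"] smult[OF Fc] Fc by simp
      then show ?case using Suc car[OF Pc, of m] car[OF Fc, of m] r c by auto
    qed
    have lt: "c * n + r < n\<^sup>2" if "r < n" "c < n" for r c
    proof -
      have "(c + 1) * n \<le> n * n" using that by (intro mult_right_mono) auto
      then show ?thesis using that by (simp add: power2_eq_square algebra_simps)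
    qed
    have "P (n\<^sup>2) = X" using X lt by (intro eq_matI) (auto simp: P_def)
    then have entry: "T X $$ (r, c) = (\<Sum>q<n\<^sup>2. x q * T (F q) $$ (r, c))"
      if "r < n" "c < n" for r c
      using part[OF that, of "n\<^sup>2"] by simp
    show ?thesis
    proof (rule eq_vecI)
      show "dim_vec (vectorize (T X)) = dim_vec (K *\<^sub>v vectorize X)"
        using car[OF X] by (simp add: vectorize_def K_def power2_eq_square)
      fix p assume "p < dim_vec (K *\<^sub>v vectorize X)"
      then have p: "p < n\<^sup>2" by (simp add: K_def)
      then have n: "n > 0" by (cases n) auto
      have pn: "p mod n < n" "p div n < n"
        using p n by (auto simp: power2_eq_square less_mult_imp_div_less)
      have "vectorize (T X) $ p = T X $$ (p mod n, p div n)"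
        using car[OF X] p by (simp add: vectorize_def power2_eq_square)
      also have "\<dots> = (\<Sum>q<n\<^sup>2. x q * T (F q) $$ (p mod n, p div n))"
        using entry pn by blast
      also have "\<dots> = (K *\<^sub>v vectorize X) $ p"
        using X p by (auto simp: K_def scalar_prod_def vectorize_def x_def power2_eq_square
            lessThan_atLeast0 mult.commute intro!: sum.cong)
      finally show "vectorize (T X) $ p = (K *\<^sub>v vectorize X) $ p" .
    qed
  qed
  have "represents n K T"
    unfolding represents_def using main by (simp add: K_def)
  then show ?thesis unfolding n_def by blast
qed

end

theory Submission
  imports Defs "Jordan_Normal_Form.Determinant"
begin

text \<open>A symmetric (antisymmetric) \<open>M\<close> makes \<open>J \<otimes> M\<close> an eigenvector of the partial transposition
  for the eigenvalue \<open>1\<close> (\<open>-1\<close>).  The normalized products form a real orthonormal basis, so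
  \<open>V\<close> is a square orthogonal matrix with \<open>K\<^sub>B V = V D\<close>, whence \<open>K\<^sub>B = V D V\<^sup>T\<close>.
  The first \<open>k\<close> columns are exactly the symmetric ones because the symmetric part of the
  family has \<open>k\<close> elements and is listed first.\<close>

section \<open>Single-entry matrices and the symmetric and antisymmetric basis\<close>

lemma single_entry_carrier [simp]: "single_entry d i j \<in> carrier_mat d d"
  by (simp add: single_entry_def)

lemma single_entry_dim [simp]:
  "dim_row (single_entry d i j) = d" "dim_col (single_entry d i j) = d"
  by (simp_all add: single_entry_def)

lemma single_entry_index [simp]:
  "r < d \<Longrightarrow> c < d \<Longrightarrow> single_entry d i j $$ (r, c) = (if r = i \<and> c = j then 1 else 0)"
  by (simp add: single_entry_def)

text \<open>Hence the product term in \<open>E_S\<close> vanishes for \<open>i < j\<close>, and for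
  \<open>i = j\<close> it removes the second of the two equal summands.\<close>

lemma single_entry_square:
  assumes "i < d" "j < d"
  shows "single_entry d i j * single_entry d i j = (if i = j then single_entry d i i else 0\<^sub>m d d)"
proof (rule eq_matI)
  fix r c
  assume "r < dim_row (if i = j then single_entry d i i else 0\<^sub>m d d)"
    and "c < dim_col (if i = j then single_entry d i i else 0\<^sub>m d d)"
  then have rc: "r < d" "c < d" by (auto split: if_splits)
  have "(single_entry d i j * single_entry d i j) $$ (r, c)
      = (\<Sum>q<d. (if r = i \<and> q = j then 1 else 0) * (if q = i \<and> c = j then 1 else 0))"
    using rc by (simp add: scalar_prod_def lessThan_atLeast0)
  also have "\<dots> = (\<Sum>q<d. if q = j then (if r = i \<and> i = j \<and> c = j then 1 else 0) else 0)"
    by (rule sum.cong) auto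
  also have "\<dots> = (if r = i \<and> i = j \<and> c = j then 1 else 0)"
    using assms by simp
  finally show "(single_entry d i j * single_entry d i j) $$ (r, c)
      = (if i = j then single_entry d i i else 0\<^sub>m d d) $$ (r, c)"
    using rc by auto
qed (auto split: if_splits)

text \<open>One index pair per matrix: \<open>i \<le> j\<close> gives the element of \<open>E_S\<close> with indices \<open>i, j\<close>, and
  \<open>i > j\<close> gives the element of \<open>E_AS\<close> with indices \<open>j, i\<close>.\<close>

definition sym_basis :: "nat \<Rightarrow> nat \<Rightarrow> nat \<Rightarrow> complex mat" where
  "sym_basis d i j =
     (if i \<le> j then single_entry d i j + single_entry d j i - single_entry d i j * single_entry d i j
      else single_entry d j i - single_entry d i j)"

text \<open>The eigenvalue of transposition at \<open>sym_basis d i j\<close>.\<close>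

definition sym_sign :: "nat \<Rightarrow> nat \<Rightarrow> complex" where
  "sym_sign i j = (if i \<le> j then 1 else - 1)"

text \<open>The entries of \<open>sym_basis d i j\<close> without the dimension \<open>d\<close>.
  The entry \<open>(j, i)\<close> always has weight 1; for \<open>i = j\<close> both tests coincide
  and both values are 1.\<close>

definition sym_coeff :: "nat \<Rightarrow> nat \<Rightarrow> nat \<Rightarrow> nat \<Rightarrow> complex" where
  "sym_coeff i j r c =
     (if r = i \<and> c = j then sym_sign i j else if r = j \<and> c = i then 1 else 0)"

text \<open>The second weight is set to 0 for \<open>i = j\<close> because the only nonzero entry is
  then already counted by the first summand.\<close>

lemma sym_coeff_eq_sum:
  "sym_coeff i j r c = (if r = j \<and> c = i then 1 else 0) +
     (if i = j then 0 else sym_sign i j) * (if r = i \<and> c = j then 1 else 0)"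
proof (cases "i = j")
  case True
  then show ?thesis by (simp add: sym_coeff_def sym_sign_def)
next
  case False
  then show ?thesis
    unfolding sym_coeff_def by (cases "r = i"; cases "c = j"; simp)
qed

text \<open>The left side is the entrywise scalar product of two basis matrices: the first one is
  supported on \<open>(j, i)\<close> and \<open>(i, j)\<close>, so only these entries of the second
  contribute. The values 1 and 2 are the squared norms.\<close>

lemma sym_coeff_orthogonal:
  "sym_coeff i' j' j i + (if i = j then 0 else sym_sign i j) * sym_coeff i' j' i j
     = (if i = i' \<and> j = j' then if i = j then 1 else 2 else 0)"
  by (cases i j rule: linorder_cases; cases i' j' rule: linorder_cases)
    (auto simp: sym_coeff_def sym_sign_def)

lemma sym_basis_carrier [simp]: "sym_basis d i j \<in> carrier_mat d d"
  unfolding sym_basis_def by (auto intro!: carrier_matI)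

lemma sym_basis_dim [simp]: "dim_row (sym_basis d i j) = d" "dim_col (sym_basis d i j) = d"
  using carrier_matD[OF sym_basis_carrier] by simp_all

lemma sym_basis_index:
  assumes "i < d" "j < d" "r < d" "c < d"
  shows "sym_basis d i j $$ (r, c) = sym_coeff i j r c"
proof (cases i j rule: linorder_cases)
  case less
  then show ?thesis
    using assms by (simp add: sym_basis_def single_entry_square sym_coeff_def sym_sign_def)
next
  case equal
  then show ?thesis
    using assms by (simp add: sym_basis_def single_entry_square sym_coeff_def sym_sign_def)
next
  case greater
  then show ?thesis
    using assms by (simp add: sym_basis_def sym_coeff_def sym_sign_def)
qed

text \<open>Transposition exchanges the weights 1 and \<open>sym_sign i j\<close>; as the sign
  squares to 1, this amounts to scaling by the sign.\<close>

lemma sym_basis_transpose: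
  assumes "i < d" "j < d"
  shows "transpose_mat (sym_basis d i j) = sym_sign i j \<cdot>\<^sub>m sym_basis d i j"
proof (rule eq_matI)
  fix r c
  assume "r < dim_row (sym_sign i j \<cdot>\<^sub>m sym_basis d i j)"
    and "c < dim_col (sym_sign i j \<cdot>\<^sub>m sym_basis d i j)"
  then have rc: "r < d" "c < d" by simp_all
  have "sym_coeff i j c r = sym_sign i j * sym_coeff i j r c"
    by (cases i j rule: linorder_cases) (auto simp: sym_coeff_def sym_sign_def)
  then show "transpose_mat (sym_basis d i j) $$ (r, c)
      = (sym_sign i j \<cdot>\<^sub>m sym_basis d i j) $$ (r, c)"
    using assms rc by (simp add: sym_basis_index)
qed simp_all

lemma E_S_eq: "E_S d = {sym_basis d i j | i j. i \<le> j \<and> j < d}"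
proof -
  have "X = single_entry d i j + single_entry d j i - single_entry d i j * single_entry d i j
      \<and> i \<le> j \<and> j < d \<longleftrightarrow> X = sym_basis d i j \<and> i \<le> j \<and> j < d" for X i j
    by (simp add: sym_basis_def cong: conj_cong)
  then show ?thesis unfolding E_S_def by simp
qed

lemma E_AS_eq: "E_AS d = {sym_basis d i j | i j. j < i \<and> i < d}"
proof -
  have "X = single_entry d j i - single_entry d i j \<and> j < i \<and> i < d
      \<longleftrightarrow> X = sym_basis d i j \<and> j < i \<and> i < d" for X i j
    by (auto simp: sym_basis_def)
  moreover have "E_AS d = {X. \<exists>i j. X = single_entry d j i - single_entry d i j \<and> j < i \<and> i < d}"
    \<comment> \<open>Exchanging the quantifiers renames \<open>i\<close> and \<open>j\<close>,
      after which both sides agree up to bound names.\<close>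
    unfolding E_AS_def by (subst ex_comm) (rule refl)
  ultimately show ?thesis by simp
qed

text \<open>The triangles \<open>i \<le> j\<close> and \<open>j < i\<close> tile the square of index
  pairs.\<close>

lemma E_S_un_E_AS: "E_S d \<union> E_AS d = {sym_basis d i j | i j. i < d \<and> j < d}"
proof -
  have "(i \<le> j \<and> j < d) \<or> (j < i \<and> i < d) \<longleftrightarrow> i < d \<and> j < d" for i j by auto
  then show ?thesis unfolding E_S_eq E_AS_eq by blast
qed

section \<open>The product family, indexed by quadruples\<close>

text \<open>Indexing by quadruples turns orthonormality, injectivity and cardinality into questions
  about indices.\<close>

definition basis_prod :: "nat \<Rightarrow> nat \<Rightarrow> nat \<times> nat \<times> nat \<times> nat \<Rightarrow> complex mat" where
  "basis_prod dA dB = (\<lambda>(a, b, i, j). single_entry dA a b \<otimes>\<^sub>K sym_basis dB i j)"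

definition basis_ind :: "nat \<Rightarrow> nat \<Rightarrow> (nat \<times> nat \<times> nat \<times> nat) set" where
  "basis_ind dA dB = {..<dA} \<times> {..<dA} \<times> {..<dB} \<times> {..<dB}"

definition sym_ind :: "nat \<Rightarrow> nat \<Rightarrow> (nat \<times> nat \<times> nat \<times> nat) set" where
  "sym_ind dA dB = {..<dA} \<times> {..<dA} \<times> {(i, j). i \<le> j \<and> j < dB}"

lemma sym_ind_subset: "sym_ind dA dB \<subseteq> basis_ind dA dB"
  by (auto simp: sym_ind_def basis_ind_def)

lemma finite_basis_ind [simp]: "finite (basis_ind dA dB)"
  by (simp add: basis_ind_def)

lemma product_family_sym:
  "product_family dA (E_S dB) = (\<lambda>x. normalize_mat (basis_prod dA dB x)) ` sym_ind dA dB"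
  unfolding product_family_def E_S_eq sym_ind_def basis_prod_def by (auto simp: image_iff) blast+

lemma product_family_all:
  "product_family dA (E_S dB \<union> E_AS dB)
     = (\<lambda>x. normalize_mat (basis_prod dA dB x)) ` basis_ind dA dB"
  unfolding product_family_def E_S_un_E_AS basis_ind_def basis_prod_def
  by (auto simp: image_iff) blast+

lemma kronecker_carrier:
  "A \<in> carrier_mat m m \<Longrightarrow> B \<in> carrier_mat n n \<Longrightarrow> A \<otimes>\<^sub>K B \<in> carrier_mat (m * n) (m * n)"
  by (auto simp: kronecker_def)

lemma kronecker_smult_right: "A \<otimes>\<^sub>K (c \<cdot>\<^sub>m B) = c \<cdot>\<^sub>m (A \<otimes>\<^sub>K B)"
proof (rule eq_matI)
  fix r s
  assume "r < dim_row (c \<cdot>\<^sub>m (A \<otimes>\<^sub>K B))" "s < dim_col (c \<cdot>\<^sub>m (A \<otimes>\<^sub>K B))"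
  then have "r < dim_row A * dim_row B" "s < dim_col A * dim_col B"
    by (auto simp: kronecker_def)
  \<comment> \<open>An existing entry forces \<open>B\<close> to be nonempty, so the remainders are
    valid indices of \<open>B\<close>.\<close>
  moreover from this have "dim_row B > 0" "dim_col B > 0"
    by (auto intro: Nat.gr0I)
  ultimately show "(A \<otimes>\<^sub>K (c \<cdot>\<^sub>m B)) $$ (r, s) = (c \<cdot>\<^sub>m (A \<otimes>\<^sub>K B)) $$ (r, s)"
    by (simp add: kronecker_def)
qed (simp_all add: kronecker_def)

lemma basis_prod_carrier: "basis_prod dA dB x \<in> carrier_mat (dA * dB) (dA * dB)"
  by (cases x) (auto simp: basis_prod_def intro!: kronecker_carrier)

text \<open>Only the second factor is transposed, and it is an eigenvector of transposition;
  homogeneity of \<open>T\<close> carries the eigenvalue through normalization.\<close>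

lemma partial_transpose_basis:
  assumes T: "is_partial_transpose dA dB T" and x: "(a, b, i, j) \<in> basis_ind dA dB"
  shows "T (normalize_mat (basis_prod dA dB (a, b, i, j)))
       = sym_sign i j \<cdot>\<^sub>m normalize_mat (basis_prod dA dB (a, b, i, j))"
proof -
  let ?X = "basis_prod dA dB (a, b, i, j)"
  have "T ?X = single_entry dA a b \<otimes>\<^sub>K transpose_mat (sym_basis dB i j)"
    using T unfolding is_partial_transpose_def basis_prod_def by simp
  also have "\<dots> = sym_sign i j \<cdot>\<^sub>m ?X"
    using x by (simp add: basis_ind_def sym_basis_transpose kronecker_smult_right basis_prod_def)
  finally have "T ?X = sym_sign i j \<cdot>\<^sub>m ?X" .
  moreover have "T (c \<cdot>\<^sub>m ?X) = c \<cdot>\<^sub>m T ?X" for c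
    using T basis_prod_carrier unfolding is_partial_transpose_def by blast
  moreover have "c \<cdot>\<^sub>m (s \<cdot>\<^sub>m ?X) = s \<cdot>\<^sub>m (c \<cdot>\<^sub>m ?X)" for c s
    by (rule eq_matI) auto
  ultimately show ?thesis
    unfolding normalize_mat_def by metis
qed

section \<open>Positions of entries under vectorization\<close>

text \<open>Column stacking sends the entry in row \<open>a * dB + i\<close> and column
  \<open>b * dB + j\<close> here; it is entry \<open>(i, j)\<close> of block
  \<open>(a, b)\<close>.\<close>

definition entry_pos :: "nat \<Rightarrow> nat \<Rightarrow> nat \<Rightarrow> nat \<Rightarrow> nat \<Rightarrow> nat \<Rightarrow> nat" where
  "entry_pos dA dB a b i j = (b * dB + j) * (dA * dB) + (a * dB + i)"

lemma mult_add_less_mult: "a * d + i < m * d" if "a < m" "i < d" for a d i m :: nat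
proof -
  have "(a + 1) * d \<le> m * d" using that by (intro mult_right_mono) auto
  then show ?thesis using that by simp
qed

context
  fixes dA dB a b i j :: nat
  assumes ind: "(a, b, i, j) \<in> basis_ind dA dB"
begin

text \<open>Mixed-radix decoding: division by \<open>dA * dB\<close> separates column from row, and
  division by \<open>dB\<close> separates block from offset.\<close>

lemma entry_pos_mod_div:
  "(entry_pos dA dB a b i j mod (dA * dB)) div dB = a"
  "(entry_pos dA dB a b i j mod (dA * dB)) mod dB = i"
  "(entry_pos dA dB a b i j div (dA * dB)) div dB = b"
  "(entry_pos dA dB a b i j div (dA * dB)) mod dB = j"
proof -
  have *: "a * dB + i < dA * dB" "i < dB" "j < dB" "dA > 0"
    using ind mult_add_less_mult by (auto simp: basis_ind_def)
  have m: "entry_pos dA dB a b i j mod (dA * dB) = a * dB + i"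
    unfolding entry_pos_def using * by (metis mod_mult_self3 mod_less)
  have "entry_pos dA dB a b i j div (dA * dB) = (b * dB + j) + (a * dB + i) div (dA * dB)"
    unfolding entry_pos_def using * by (subst div_mult_self3) auto
  then have d: "entry_pos dA dB a b i j div (dA * dB) = b * dB + j"
    using * by simp
  show "(entry_pos dA dB a b i j mod (dA * dB)) div dB = a"
    "(entry_pos dA dB a b i j mod (dA * dB)) mod dB = i"
    "(entry_pos dA dB a b i j div (dA * dB)) div dB = b"
    "(entry_pos dA dB a b i j div (dA * dB)) mod dB = j"
    unfolding m d using * by auto
qed

lemma entry_pos_less: "entry_pos dA dB a b i j < (dA * dB)\<^sup>2"
  unfolding entry_pos_def power2_eq_square
  using ind by (intro mult_add_less_mult) (auto simp: basis_ind_def)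

lemma entry_pos_eq_iff:
  "p = entry_pos dA dB a b i j \<longleftrightarrow>
     p mod (dA * dB) div dB = a \<and> p div (dA * dB) div dB = b \<and>
     p mod (dA * dB) mod dB = i \<and> p div (dA * dB) mod dB = j"
proof
  assume "p mod (dA * dB) div dB = a \<and> p div (dA * dB) div dB = b \<and>
     p mod (dA * dB) mod dB = i \<and> p div (dA * dB) mod dB = j"
  then have "p mod (dA * dB) = a * dB + i" "p div (dA * dB) = b * dB + j"
    by (metis div_mult_mod_eq)+
  then show "p = entry_pos dA dB a b i j"
    unfolding entry_pos_def by (metis div_mult_mod_eq)
qed (use entry_pos_mod_div in auto)

text \<open>The single-entry factor selects the block \<open>(a, b)\<close>, which contains a copy
  of \<open>sym_basis dB i j\<close>.\<close>

lemma vectorize_basis_prod_index: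
  assumes "p < (dA * dB)\<^sup>2"
  shows "vectorize (basis_prod dA dB (a, b, i, j)) $ p =
    (if p mod (dA * dB) div dB = a \<and> p div (dA * dB) div dB = b
     then sym_coeff i j (p mod (dA * dB) mod dB) (p div (dA * dB) mod dB) else 0)"
proof -
  have pos: "dA > 0" "dB > 0" using ind by (auto simp: basis_ind_def)
  have "p mod (dA * dB) < dA * dB" "p div (dA * dB) < dA * dB"
    using assms pos by (auto simp: power2_eq_square less_mult_imp_div_less)
  moreover from this have "p mod (dA * dB) div dB < dA" "p div (dA * dB) div dB < dA"
    by (auto intro: less_mult_imp_div_less)
  ultimately show ?thesis
    using assms pos ind
    by (auto simp: vectorize_def basis_prod_def kronecker_def power2_eq_square sym_basis_index
        basis_ind_def)
qed

end

section \<open>Orthonormality of the vectorized family\<close>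

lemma vectorize_carrier: "X \<in> carrier_mat n n \<Longrightarrow> vectorize X \<in> carrier_vec (n\<^sup>2)"
  unfolding vectorize_def power2_eq_square by (metis carrier_matD vec_carrier)

text \<open>This sparse form reduces a scalar product to reading off at most two entries of the
  other vector.\<close>

lemma vectorize_basis_prod:
  assumes ind: "(a, b, i, j) \<in> basis_ind dA dB"
  shows "vectorize (basis_prod dA dB (a, b, i, j)) =
     unit_vec ((dA * dB)\<^sup>2) (entry_pos dA dB a b j i) +
     (if i = j then 0 else sym_sign i j) \<cdot>\<^sub>v unit_vec ((dA * dB)\<^sup>2) (entry_pos dA dB a b i j)"
proof (rule eq_vecI)
  fix p
  have swap: "(a, b, j, i) \<in> basis_ind dA dB" using ind by (auto simp: basis_ind_def)
  assume "p < dim_vec (unit_vec ((dA * dB)\<^sup>2) (entry_pos dA dB a b j i) +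
     (if i = j then 0 else sym_sign i j) \<cdot>\<^sub>v unit_vec ((dA * dB)\<^sup>2) (entry_pos dA dB a b i j))"
  then have p: "p < (dA * dB)\<^sup>2" by simp
  have "(unit_vec ((dA * dB)\<^sup>2) (entry_pos dA dB a b j i) +
     (if i = j then 0 else sym_sign i j) \<cdot>\<^sub>v unit_vec ((dA * dB)\<^sup>2) (entry_pos dA dB a b i j)) $ p
    = (if p = entry_pos dA dB a b j i then 1 else 0) +
      (if i = j then 0 else sym_sign i j) * (if p = entry_pos dA dB a b i j then 1 else 0)"
    using p entry_pos_less[OF ind] entry_pos_less[OF swap] by (simp add: unit_vec_def)
  also have "\<dots> = vectorize (basis_prod dA dB (a, b, i, j)) $ p"
    \<comment> \<open>Outside the block \<open>(a, b)\<close> every indicator vanishes; inside it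
      the two sides become identical.\<close>
    unfolding vectorize_basis_prod_index[OF ind p] entry_pos_eq_iff[OF ind]
      entry_pos_eq_iff[OF swap] sym_coeff_eq_sum
    by (cases "p mod (dA * dB) div dB = a"; cases "p div (dA * dB) div dB = b")
      (simp_all only: simp_thms if_True if_False add_0 mult_zero_right)
  finally show "vectorize (basis_prod dA dB (a, b, i, j)) $ p =
    (unit_vec ((dA * dB)\<^sup>2) (entry_pos dA dB a b j i) +
     (if i = j then 0 else sym_sign i j) \<cdot>\<^sub>v unit_vec ((dA * dB)\<^sup>2) (entry_pos dA dB a b i j)) $ p"
    by (rule sym)
qed (simp add: carrier_vecD[OF vectorize_carrier[OF basis_prod_carrier]])

text \<open>Different blocks have disjoint supports; within a common block the sum is the one
  evaluated in \<open>sym_coeff_orthogonal\<close>.\<close>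

lemma vectorize_basis_prod_scalar:
  assumes x: "(a, b, i, j) \<in> basis_ind dA dB" and y: "(a', b', i', j') \<in> basis_ind dA dB"
  shows "vectorize (basis_prod dA dB (a, b, i, j)) \<bullet> vectorize (basis_prod dA dB (a', b', i', j'))
     = (if (a, b, i, j) = (a', b', i', j') then if i = j then 1 else 2 else 0)"
proof -
  let ?w = "vectorize (basis_prod dA dB (a', b', i', j'))"
  let ?s = "if i = j then 0 else sym_sign i j"
  have swap: "(a, b, j, i) \<in> basis_ind dA dB" using x by (auto simp: basis_ind_def)
  have w: "?w \<in> carrier_vec ((dA * dB)\<^sup>2)" by (rule vectorize_carrier[OF basis_prod_carrier])
  have "vectorize (basis_prod dA dB (a, b, i, j)) \<bullet> ?w
      = ?w $ entry_pos dA dB a b j i + ?s * ?w $ entry_pos dA dB a b i j"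
    unfolding vectorize_basis_prod[OF x] using w entry_pos_less[OF x] entry_pos_less[OF swap]
    by (subst add_scalar_prod_distrib[of _ "(dA * dB)\<^sup>2"]) auto
  also have "\<dots> = (if a = a' \<and> b = b'
      then sym_coeff i' j' j i + ?s * sym_coeff i' j' i j else 0)"
    unfolding vectorize_basis_prod_index[OF y entry_pos_less[OF x]]
      vectorize_basis_prod_index[OF y entry_pos_less[OF swap]]
      entry_pos_mod_div[OF x] entry_pos_mod_div[OF swap]
    by (cases "a = a'"; cases "b = b'"; simp)
  finally show ?thesis
    unfolding sym_coeff_orthogonal by (cases "a = a'"; cases "b = b'"; simp)
qed

text \<open>Column stacking is a bijection between positions and index pairs, with inverse
  \<open>c * n + r\<close>.\<close>

lemma sum_square_mod_div:
  fixes f :: "nat \<Rightarrow> nat \<Rightarrow> 'a::comm_monoid_add"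
  shows "(\<Sum>p<n\<^sup>2. f (p mod n) (p div n)) = (\<Sum>r<n. \<Sum>c<n. f r c)"
proof -
  have "(\<Sum>p<n\<^sup>2. f (p mod n) (p div n)) = (\<Sum>(r, c)\<in>{..<n} \<times> {..<n}. f r c)"
  proof (rule sum.reindex_bij_witness[where i = "\<lambda>(r, c). c * n + r" and j = "\<lambda>p. (p mod n, p div n)"])
    fix p assume "p \<in> {..<n\<^sup>2}"
    then have "p < n * n" by (simp add: power2_eq_square)
    moreover from this have "n > 0" by (cases n) auto
    ultimately show "(p mod n, p div n) \<in> {..<n} \<times> {..<n}"
      by (simp add: less_mult_imp_div_less)
  qed (auto simp: power2_eq_square mult_add_less_mult)
  then show ?thesis by (simp add: sum.cartesian_product)
qed

text \<open>The scalar product here is bilinear, without conjugation; for a real entry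
  \<open>z * z\<close> is nevertheless the squared modulus.\<close>

lemma frobenius_norm_square:
  assumes X: "X \<in> carrier_mat n n"
    and real: "\<And>r c. r < n \<Longrightarrow> c < n \<Longrightarrow> X $$ (r, c) \<in> \<real>"
  shows "(complex_of_real (frobenius_norm X))\<^sup>2 = vectorize X \<bullet> vectorize X"
proof -
  have sq: "complex_of_real ((cmod z)\<^sup>2) = z * z" if "z \<in> \<real>" for z
    using that by (auto elim!: Reals_cases simp: power2_eq_square simp flip: of_real_mult)
  have dim: "dim_row X = n" "dim_col X = n" using X by (rule carrier_matD)+
  have "(frobenius_norm X)\<^sup>2 = (\<Sum>r<n. \<Sum>c<n. (cmod (X $$ (r, c)))\<^sup>2)"
    unfolding frobenius_norm_def dim by (intro real_sqrt_pow2 sum_nonneg zero_le_power2)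
  then have "(complex_of_real (frobenius_norm X))\<^sup>2
      = (\<Sum>r<n. \<Sum>c<n. complex_of_real ((cmod (X $$ (r, c)))\<^sup>2))"
    by (simp flip: of_real_power)
  also have "\<dots> = (\<Sum>r<n. \<Sum>c<n. X $$ (r, c) * X $$ (r, c))"
    using real by (intro sum.cong refl sq) auto
  also have "\<dots> = (\<Sum>p<n\<^sup>2. X $$ (p mod n, p div n) * X $$ (p mod n, p div n))"
    by (rule sum_square_mod_div[symmetric])
  also have "\<dots> = vectorize X \<bullet> vectorize X"
    by (simp add: scalar_prod_def vectorize_def dim power2_eq_square lessThan_atLeast0)
  finally show ?thesis .
qed

lemma vectorize_smult: "vectorize (c \<cdot>\<^sub>m X) = c \<cdot>\<^sub>v vectorize X"
proof (rule eq_vecI)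
  fix p assume "p < dim_vec (c \<cdot>\<^sub>v vectorize X)"
  then have p: "p < dim_row X * dim_col X" by (simp add: vectorize_def)
  then have "dim_row X > 0" by (auto intro: Nat.gr0I)
  moreover have "p div dim_row X < dim_col X"
    using p by (intro less_mult_imp_div_less) (simp only: mult.commute)
  ultimately show "vectorize (c \<cdot>\<^sub>m X) $ p = (c \<cdot>\<^sub>v vectorize X) $ p"
    using p by (simp add: vectorize_def)
qed (simp add: vectorize_def)

lemma basis_prod_real:
  assumes "x \<in> basis_ind dA dB" "r < dA * dB" "c < dA * dB"
  shows "basis_prod dA dB x $$ (r, c) \<in> \<real>"
proof -
  obtain a b i j where x: "x = (a, b, i, j)" by (rule prod_cases4)
  have "dB > 0" using assms(2) by (auto intro: Nat.gr0I)
  \<comment> \<open>Closure of the reals under conditionals settles the nested cases of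
    \<open>sym_coeff\<close> without splitting them.\<close>
  moreover have "(if P then z else w) \<in> \<real>" if "z \<in> \<real>" "w \<in> \<real>" for P and z w :: complex
    using that by simp
  then have "sym_coeff i j p q \<in> \<real>" for p q
    unfolding sym_coeff_def sym_sign_def by (simp split del: if_split)
  moreover have "r mod dB < dB" "c mod dB < dB" using \<open>dB > 0\<close> by simp_all
  moreover have "r div dB < dA" "c div dB < dA"
    using assms(2,3) by (simp_all add: less_mult_imp_div_less)
  moreover have "i < dB" "j < dB" using assms(1) by (simp_all add: x basis_ind_def)
  ultimately show ?thesis
    using assms(2,3) by (simp add: x basis_prod_def kronecker_def sym_basis_index)
qed

text \<open>For distinct indices the scalar product vanishes before normalization; for equal ones it
  is the squared Frobenius norm, which is then divided out.\<close>

lemma basis_orthonormal: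
  assumes x: "x \<in> basis_ind dA dB" and y: "y \<in> basis_ind dA dB"
  shows "vectorize (normalize_mat (basis_prod dA dB x)) \<bullet> vectorize (normalize_mat (basis_prod dA dB y))
    = (if x = y then 1 else 0)"
proof -
  let ?G = "basis_prod dA dB"
  let ?c = "\<lambda>x. complex_of_real (1 / frobenius_norm (?G x))"
  have scalar: "vectorize (normalize_mat (?G x)) \<bullet> vectorize (normalize_mat (?G y))
      = ?c x * ?c y * (vectorize (?G x) \<bullet> vectorize (?G y))"
    using vectorize_carrier[OF basis_prod_carrier[of dA dB x]]
      vectorize_carrier[OF basis_prod_carrier[of dA dB y]]
    by (simp add: normalize_mat_def vectorize_smult)
  obtain a b i j where x': "x = (a, b, i, j)" by (rule prod_cases4)
  obtain a' b' i' j' where y': "y = (a', b', i', j')" by (rule prod_cases4)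
  note xy = x' y'
  note G = vectorize_basis_prod_scalar[OF x[unfolded xy] y[unfolded xy], folded xy]
  show ?thesis
  proof (cases "x = y")
    case True
    have "(complex_of_real (frobenius_norm (?G x)))\<^sup>2 = vectorize (?G x) \<bullet> vectorize (?G x)"
      using basis_prod_carrier basis_prod_real[OF x] by (rule frobenius_norm_square)
    \<comment> \<open>The value is 1 or 2, so the norm is nonzero and the division in
      \<open>normalize_mat\<close> is genuine.\<close>
    moreover have "vectorize (?G x) \<bullet> vectorize (?G x) \<noteq> 0"
      using G True by (simp split: if_splits)
    ultimately show ?thesis
      unfolding scalar using True by (auto simp: power2_eq_square)
  next
    case False
    then show ?thesis unfolding scalar using G by simp
  qed
qed

text \<open>Equal matrices at distinct indices would have scalar product both 0 and 1.\<close>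

lemma basis_inj: "inj_on (\<lambda>x. normalize_mat (basis_prod dA dB x)) (basis_ind dA dB)"
proof (rule inj_onI)
  fix x y
  assume xy: "x \<in> basis_ind dA dB" "y \<in> basis_ind dA dB"
    and eq: "normalize_mat (basis_prod dA dB x) = normalize_mat (basis_prod dA dB y)"
  show "x = y"
    using basis_orthonormal[OF xy] basis_orthonormal[OF xy(1,1)] unfolding eq by (auto split: if_splits)
qed

section \<open>Counting and ordering of the family\<close>

lemma card_basis_ind: "card (basis_ind dA dB) = (dA * dB)\<^sup>2"
  by (simp add: basis_ind_def card_cartesian_product power2_eq_square)

text \<open>Fixing the larger index \<open>j\<close> leaves \<open>j + 1\<close> choices for
  \<open>i\<close>, which sum to a triangular number. The doubled form avoids division of
  naturals.\<close>

lemma card_sym_ind: "2 * card (sym_ind dA dB) = dA\<^sup>2 * (dB * (dB + 1))"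
proof -
  have eq: "{(i, j). i \<le> j \<and> j < dB} = (\<lambda>(j, i). (i, j)) ` (SIGMA j:{..<dB}. {..j})"
    by (auto simp: image_iff)
  have "card {(i, j). i \<le> j \<and> j < dB} = card (SIGMA j:{..<dB}. {..j})"
    unfolding eq by (rule card_image) (auto simp: inj_on_def)
  also have "\<dots> = (\<Sum>j<dB. Suc j)" by simp
  finally have "card {(i, j). i \<le> j \<and> j < dB} = (\<Sum>j<dB. Suc j)" .
  moreover have "2 * (\<Sum>j<dB. Suc j) = dB * (dB + 1)" by (induction dB) auto
  ultimately show ?thesis
    unfolding sym_ind_def by (simp add: card_cartesian_product power2_eq_square)
qed

text \<open>An element \<open>q\<close> brings all \<open>q + 1\<close> numbers up to
  \<open>q\<close> into \<open>S\<close>, so \<open>q < card S\<close>; the resulting inclusion is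
  between sets of equal size.\<close>

lemma downward_closed_eq_lessThan_card:
  fixes S :: "nat set"
  assumes "finite S" and down: "\<And>p q. q \<in> S \<Longrightarrow> p < q \<Longrightarrow> p \<in> S"
  shows "S = {..<card S}"
proof -
  have "S \<subseteq> {..<card S}"
  proof
    fix q assume "q \<in> S"
    then have "{..q} \<subseteq> S" using down by (auto simp: le_less)
    then have "card {..q} \<le> card S" using \<open>finite S\<close> by (rule card_mono[rotated])
    then show "q \<in> {..<card S}" by simp
  qed
  then show ?thesis by (intro card_subset_eq) auto
qed

text \<open>The ordering makes the positions of symmetric elements downward closed, and distinctness
  of the list makes them as numerous as the symmetric indices.\<close>

lemma ordered_family_prefix:
  assumes fam: "is_ordered_family dA dB Es" and m: "m < length Es"
  shows "Es ! m \<in> product_family dA (E_S dB) \<longleftrightarrow> m < card (sym_ind dA dB)"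
proof -
  let ?P = "product_family dA (E_S dB)"
  define S where "S = {q. q < length Es \<and> Es ! q \<in> ?P}"
  have dist: "distinct Es" and set: "set Es = product_family dA (E_S dB \<union> E_AS dB)"
    and ord: "\<And>p q. q < length Es \<Longrightarrow> p < q \<Longrightarrow> Es ! q \<in> ?P \<Longrightarrow> Es ! p \<in> ?P"
    using fam unfolding is_ordered_family_def by blast+
  have "?P \<subseteq> set Es"
    unfolding set by (auto simp: product_family_def)
  then have "(!) Es ` S = ?P"
    unfolding S_def by (auto simp: in_set_conv_nth image_iff subset_iff)
  moreover have "inj_on ((!) Es) S"
    using dist by (auto simp: S_def inj_on_def nth_eq_iff_index_eq)
  ultimately have "card S = card ?P" by (metis card_image)
  also have "\<dots> = card (sym_ind dA dB)"
    unfolding product_family_sym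
    by (intro card_image inj_on_subset[OF basis_inj] sym_ind_subset)
  finally have "S = {..<card (sym_ind dA dB)}"
    using downward_closed_eq_lessThan_card[of S] ord by (auto simp: S_def)
  then show ?thesis using m by (auto simp: S_def)
qed

text \<open>This makes the matrix of vectorized elements square.\<close>

lemma ordered_family_length:
  assumes "is_ordered_family dA dB Es"
  shows "length Es = (dA * dB)\<^sup>2"
proof -
  have "length Es = card (product_family dA (E_S dB \<union> E_AS dB))"
    using assms unfolding is_ordered_family_def by (metis distinct_card)
  then show ?thesis
    unfolding product_family_all by (simp add: card_image[OF basis_inj] card_basis_ind)
qed

section \<open>Diagonalization of the partial transposition\<close>

lemma four_block_sign:
  "four_block_mat (1\<^sub>m k) (0\<^sub>m k l) (0\<^sub>m l k) (- 1\<^sub>m l)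
     = (mat (k + l) (k + l) (\<lambda>(i, j). if i = j then if i < k then 1 else - 1 else 0) :: 'a::ring_1 mat)"
  by (rule eq_matI) auto

theorem mainTheorem6:
  fixes dA dB k l :: nat
    and T :: "complex mat \<Rightarrow> complex mat"
    and K\<^sub>B :: "complex mat"
    and Es :: "complex mat list"
  assumes "dA \<ge> 1" and "dB \<ge> 1"
    and "is_partial_transpose dA dB T"
    and "represents (dA * dB) K\<^sub>B T"
    and "is_ordered_family dA dB Es"
    and "real k = 1 / 2 * real dA ^ 2 * real dB * (real dB + 1)"
    and "real l = 1 / 2 * real dA ^ 2 * real dB * (real dB - 1)"
  shows "K\<^sub>B = vec_matrix (dA * dB) Es
                * four_block_mat (1\<^sub>m k) (0\<^sub>m k l) (0\<^sub>m l k) (- 1\<^sub>m l)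
                * transpose_mat (vec_matrix (dA * dB) Es)"
proof -
  define n N where "n = dA * dB" and "N = n\<^sup>2"
  define V where "V = vec_matrix n Es"
  define D :: "complex mat" where "D = four_block_mat (1\<^sub>m k) (0\<^sub>m k l) (0\<^sub>m l k) (- 1\<^sub>m l)"
  let ?F = "\<lambda>x. normalize_mat (basis_prod dA dB x)"
  note T = assms(3) and fam = assms(5)
  have K: "K\<^sub>B \<in> carrier_mat N N"
    and rep: "\<And>X. X \<in> carrier_mat n n \<Longrightarrow> K\<^sub>B *\<^sub>v vectorize X = vectorize (T X)"
    using assms(4) by (auto simp: represents_def n_def N_def)
  have len: "length Es = N" using ordered_family_length[OF fam] by (simp add: N_def n_def)
  \<comment> \<open>Doubling clears the factor 1/2, so the equation descends to the
    naturals.\<close>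
  have "real (2 * k) = real (dA\<^sup>2 * (dB * (dB + 1)))"
    using assms(6) by (simp add: algebra_simps)
  then have "2 * k = dA\<^sup>2 * (dB * (dB + 1))" by (simp only: of_nat_eq_iff)
  then have k: "k = card (sym_ind dA dB)" using card_sym_ind[of dA dB] by simp
  \<comment> \<open>The factors \<open>dB + 1\<close> and \<open>dB - 1\<close> average to
    \<open>dB\<close>.\<close>
  have "real (k + l) = real N"
    using assms(6,7) by (simp add: N_def n_def power2_eq_square field_simps)
  then have kl: "k + l = N" by (simp only: of_nat_eq_iff)
  have elem: "\<exists>x \<in> basis_ind dA dB. Es ! m = ?F x" if "m < N" for m
    using fam that len nth_mem[of m Es]
    by (auto simp: is_ordered_family_def product_family_all)
  have F: "?F x \<in> carrier_mat n n" for x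
    using basis_prod_carrier[of dA dB x] by (simp add: normalize_mat_def n_def)
  have Es: "Es ! m \<in> carrier_mat n n" if "m < N" for m
    using elem[OF that] F by auto
  have V: "V \<in> carrier_mat N N"
    by (simp add: V_def vec_matrix_def N_def[symmetric] len mat_of_cols_def)
  have col: "col V m = vectorize (Es ! m)" if "m < N" for m
    using that len vectorize_carrier[OF Es[OF that]]
    by (simp add: V_def vec_matrix_def N_def)
  have D: "D \<in> carrier_mat N N" by (simp add: D_def four_block_sign kl)
  \<comment> \<open>The entries of this Gram matrix are the scalar products of the columns.\<close>
  have "transpose_mat V * V = 1\<^sub>m N"
  proof (rule eq_matI)
    fix p q assume "p < dim_row (1\<^sub>m N)" "q < dim_col (1\<^sub>m N)"
    then have pq: "p < N" "q < N" by auto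
    obtain x y where x: "x \<in> basis_ind dA dB" "Es ! p = ?F x"
      and y: "y \<in> basis_ind dA dB" "Es ! q = ?F y"
      using elem pq by meson
    \<comment> \<open>Distinctness of \<open>Es\<close> and injectivity of the parametrization
      identify equal positions with equal indices.\<close>
    have "p = q \<longleftrightarrow> Es ! p = Es ! q"
      using fam pq len by (simp add: is_ordered_family_def nth_eq_iff_index_eq)
    then have "p = q \<longleftrightarrow> x = y"
      using x y basis_inj[of dA dB] by (auto simp: inj_on_def)
    then show "(transpose_mat V * V) $$ (p, q) = 1\<^sub>m N $$ (p, q)"
      using pq V basis_orthonormal[OF x(1) y(1)] by (simp add: col x(2) y(2))
  qed (use V in auto)
  \<comment> \<open>For square matrices a left inverse is also a right inverse.\<close>
  then have VV: "V * transpose_mat V = 1\<^sub>m N"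
    using V by (intro mat_mult_left_right_inverse[of "transpose_mat V"]) auto
  \<comment> \<open>The first \<open>k\<close> positions hold exactly the elements with
    \<open>i \<le> j\<close>, those of eigenvalue 1.\<close>
  have sign: "T (Es ! m) = (if m < k then 1 else - 1) \<cdot>\<^sub>m Es ! m" if m: "m < N" for m
  proof -
    obtain a b i j where x: "(a, b, i, j) \<in> basis_ind dA dB" "Es ! m = ?F (a, b, i, j)"
      using elem[OF m] by (auto simp: Bex_def)
    have "m < k \<longleftrightarrow> ?F (a, b, i, j) \<in> ?F ` sym_ind dA dB"
      using ordered_family_prefix[OF fam, of m] m len k x(2) by (simp add: product_family_sym)
    also have "\<dots> \<longleftrightarrow> (a, b, i, j) \<in> sym_ind dA dB"
      using basis_inj x(1) sym_ind_subset by (rule inj_on_image_mem_iff)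
    also have "\<dots> \<longleftrightarrow> i \<le> j" using x(1) by (auto simp: sym_ind_def basis_ind_def)
    finally show ?thesis
      unfolding x(2) partial_transpose_basis[OF T x(1)] by (simp add: sym_sign_def)
  qed
  have "K\<^sub>B * V = V * D"
  proof (rule eq_matI)
    fix p m assume "p < dim_row (V * D)" "m < dim_col (V * D)"
    then have pm: "p < N" "m < N" using V D by auto
    have "(K\<^sub>B * V) $$ (p, m) = (K\<^sub>B *\<^sub>v col V m) $ p"
      using K V pm by simp
    also have "K\<^sub>B *\<^sub>v col V m = (if m < k then 1 else - 1) \<cdot>\<^sub>v col V m"
      by (simp only: col[OF pm(2)] rep[OF Es[OF pm(2)]] sign[OF pm(2)] vectorize_smult)
    also have "((if m < k then 1 else - 1) \<cdot>\<^sub>v col V m) $ p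
        = (if m < k then 1 else - 1) * V $$ (p, m)"
      using pm V by (simp split del: if_split)
    \<comment> \<open>The scaled entry is expanded as a sum with one nonzero term, to match column
      \<open>m\<close> of the diagonal matrix \<open>D\<close>.\<close>
    also have "\<dots> = (\<Sum>q<N. if q = m then (if m < k then 1 else - 1) * V $$ (p, m) else 0)"
      using pm by simp
    also have "\<dots> = (\<Sum>q<N. V $$ (p, q) * D $$ (q, m))"
      using pm by (intro sum.cong) (auto simp: D_def four_block_sign kl)
    also have "\<dots> = (V * D) $$ (p, m)"
      using pm V D by (simp add: scalar_prod_def lessThan_atLeast0)
    finally show "(K\<^sub>B * V) $$ (p, m) = (V * D) $$ (p, m)" .
  qed (use K V D in auto)
  then have "V * D * transpose_mat V = K\<^sub>B * (V * transpose_mat V)"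
    using K V by (metis assoc_mult_mat transpose_carrier_mat)
  also have "\<dots> = K\<^sub>B" using K by (simp add: VV)
  finally show ?thesis unfolding V_def D_def n_def by (rule sym)
qed

end
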